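(* Let $n=p_1^{\alpha_1}p_2^{\alpha_2}\cdots p_k^{\alpha_k}$, where the $p_i$ are distinct primes and $\alpha_i\geq 1$, and suppose $n>1$ is not prime. If $H$ is a proper subgroup of $\mathbb Z_n$ of order $p_{i_1}^{\alpha_{i_1}}p_{i_2}^{\alpha_{i_2}} \cdots p_{i_r}^{\alpha_{i_r}}$ (with distinct indices $i_1,\dots,i_r\in\{1,\dots,k\}$), then $$\deg_{\mathcal P(\mathbb Z_n)}(H)= \prod_{j\in\{1,\dots,k\}\setminus \{i_1, i_2, \ldots ,i_r\}}(\alpha_j+1)\;-\;1.$$
   Context: For a finite group $G$ that is neither trivial nor of prime order, the coprime graph of subgroups $\mathcal P(G)$ is the simple graph whose vertices are the proper subgroups of $G$ (here "proper" means different from $G$ and from the trivial subgroup), two distinct vertices $H,K$ being adjacent if and only if $|H|$ and $|K|$ are coprime. $\deg_{\Gamma}(v)$ denotes the degree of the vertex $v$ in the graph $\Gamma$. *)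

theory Defs
  imports
    "HOL-Algebra.Elementary_Groups"
    "HOL-Computational_Algebra.Primes"
    "Graph_Theory.Pair_Digraph"
begin

(* Proper excludes the trivial subgroup as well as the whole group. *)
definition proper_subgroup :: "'a set \<Rightarrow> ('a, 'b) monoid_scheme \<Rightarrow> bool" where
  "proper_subgroup H G \<longleftrightarrow> subgroup H G \<and> H \<noteq> carrier G \<and> H \<noteq> {\<one>\<^bsub>G\<^esub>}"

(* A simple graph is a finite, loop-free, symmetric digraph without parallel arcs
   (locale pair_graph): an edge between H and K is the pair of arcs (H, K) and (K, H),
   so the degree of H is its out-degree.
   The definition is meant for finite G; the card of an infinite subgroup would be 0. *)
definition coprime_graph :: "('a, 'b) monoid_scheme \<Rightarrow> 'a set pair_pre_digraph" where
  "coprime_graph G =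
     \<lparr> pverts = {H. proper_subgroup H G},
       parcs = {(H, K). proper_subgroup H G \<and> proper_subgroup K G \<and> H \<noteq> K \<and>
                        coprime (card H) (card K)} \<rparr>"

lemma pair_graph_coprime_graph:
  assumes "finite (carrier G)"
  shows "pair_graph (coprime_graph G)"
proof -
  have fin: "finite {H. proper_subgroup H G}"
    by (rule finite_subset[of _ "Pow (carrier G)"])
       (auto simp: proper_subgroup_def assms dest: subgroup.subset)
  have "finite (parcs (coprime_graph G))"
    by (rule finite_subset[of _ "{H. proper_subgroup H G} \<times> {H. proper_subgroup H G}"])
       (auto simp: coprime_graph_def fin)
  then show ?thesis
    by unfold_locales
       (auto simp: coprime_graph_def fin symmetric_def sym_def coprime_commute)
qed

lemma out_degree_coprime_graph:
  assumes "proper_subgroup H G"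
  shows "out_degree (coprime_graph G) H =
    card {K. proper_subgroup K G \<and> K \<noteq> H \<and> coprime (card H) (card K)}"
proof -
  have "out_arcs (coprime_graph G) H =
      Pair H ` {K. proper_subgroup K G \<and> K \<noteq> H \<and> coprime (card H) (card K)}"
    using assms by (auto simp: out_arcs_def coprime_graph_def)
  then show ?thesis
    by (simp add: out_degree_def card_image inj_on_def)
qed

end

theory Submission
  imports Defs "HOL-Algebra.Multiplicative_Group"
begin

(* A cyclic group of order n has exactly one subgroup of each order d dividing n. A neighbour of H
   is therefore the same thing as a divisor d > 1 of n that is coprime to the order of H, and since
   each prime divides the order of H either to its full power in n or not at all, such a d is a
   divisor of the product of the remaining prime powers. *)

text \<open>Multiplying a divisor of \<open>a\<close> by a divisor of \<open>b\<close> is a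
  bijection onto the divisors of \<open>a * b\<close>; coprimality makes it injective.\<close>

lemma card_divisors_mult_coprime:
  fixes a b :: nat
  assumes "coprime a b"
  shows "card {d. d dvd a * b} = card {d. d dvd a} * card {d. d dvd b}"
proof -
  have "inj_on (\<lambda>(x, y). x * y) ({d. d dvd a} \<times> {d. d dvd b})"
  proof (rule inj_onI, clarsimp)
    fix x y x' y' assume dvd: "x dvd a" "y dvd b" "x' dvd a" "y' dvd b" and eq: "x * y = x' * y'"
    have cop: "coprime x y'" "coprime x' y" "coprime x y" "coprime x' y'"
      using assms dvd by (auto elim: coprime_divisors)
    \<comment> \<open>Each factor divides the product on the other side of \<open>eq\<close>, and
      the coprime cofactor there cancels.\<close>
    have "x dvd x'" "x' dvd x" "y dvd y'" "y' dvd y"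
      using cop eq
      by (metis coprime_dvd_mult_left_iff dvd_triv_left,
          metis coprime_dvd_mult_left_iff dvd_triv_left,
          metis coprime_commute coprime_dvd_mult_right_iff dvd_triv_right,
          metis coprime_commute coprime_dvd_mult_right_iff dvd_triv_right)
    then show "x = x' \<and> y = y'" by (simp add: dvd_antisym)
  qed
  moreover have "(\<lambda>(x, y). x * y) ` ({d. d dvd a} \<times> {d. d dvd b}) = {d. d dvd a * b}"
    by (fastforce simp: mult_dvd_mono dest: division_decomp)
  ultimately show ?thesis
    by (metis card_image card_cartesian_product)
qed

lemma card_divisors_prime_power:
  fixes p :: nat
  assumes "prime p"
  shows "card {d. d dvd p ^ a} = a + 1"
proof -
  have "{d. d dvd p ^ a} = (^) p ` {..a}"
    using divides_primepow_nat[OF assms] by auto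
  moreover have "inj_on ((^) p) {..a}"
    using prime_gt_1_nat[OF assms] by (auto intro: inj_onI)
  ultimately show ?thesis by (simp add: card_image)
qed

text \<open>Induction on \<open>J\<close>: injectivity of \<open>p\<close> makes the split-off prime
  power coprime to the rest, so the counts multiply.\<close>

lemma card_divisors_prod_prime_powers:
  fixes p :: "'a \<Rightarrow> nat"
  assumes "finite J" "\<And>j. j \<in> J \<Longrightarrow> prime (p j)" "inj_on p J"
  shows "card {d. d dvd (\<Prod>j\<in>J. p j ^ a j)} = (\<Prod>j\<in>J. a j + 1)"
  using assms
proof (induction J)
  case (insert x J)
  have "coprime (p x ^ a x) (\<Prod>j\<in>J. p j ^ a j)"
    using insert.prems insert.hyps
    by (intro prod_coprime_right) (auto intro!: primes_coprime simp: inj_on_def)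
  then have "card {d. d dvd (\<Prod>j\<in>insert x J. p j ^ a j)} =
      card {d. d dvd p x ^ a x} * card {d. d dvd (\<Prod>j\<in>J. p j ^ a j)}"
    using insert.hyps by (simp add: card_divisors_mult_coprime)
  with insert show ?case by (simp add: card_divisors_prime_power)
qed simp

text \<open>With \<open>c = n div d\<close>, the elements are exactly \<open>c * i\<close> for
  \<open>i\<close> from 0 to \<open>d - 1\<close>. This set will turn out to be the only subgroup of
  order \<open>d\<close>.\<close>

lemma card_multiples_below:
  assumes "n > 0" "d dvd n"
  shows "card {x \<in> {0..<int n}. int (n div d) dvd x} = d"
proof -
  obtain c where n: "n = d * c" using assms by blast
  with assms have pos: "d > 0" "c > 0" by auto
  have "{x \<in> {0..<int n}. int (n div d) dvd x} = (\<lambda>i. int c * i) ` {0..<int d}" (is "?L = ?R")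
  proof
    show "?L \<subseteq> ?R"
    proof
      fix x assume "x \<in> ?L"
      then obtain i where "x = int c * i" "0 \<le> int c * i" "int c * i < int c * int d"
        using pos by (auto simp: n mult.commute)
      with pos show "x \<in> ?R" by (auto simp: zero_le_mult_iff mult_less_cancel_left_pos)
    qed
    show "?R \<subseteq> ?L" using pos by (auto simp: n mult.commute)
  qed
  moreover have "inj_on (\<lambda>i. int c * i) {0..<int d}" using pos by (auto intro: inj_onI)
  ultimately show ?thesis by (simp add: card_image)
qed

lemma subgroup_multiples_integer_mod_group:
  assumes "n > 0" "c dvd n"
  shows "subgroup {x \<in> {0..<int n}. int c dvd x} (integer_mod_group n)"
proof -
  interpret group "integer_mod_group n" by simp
  show ?thesis
  proof (rule subgroupI)
    show "{x \<in> {0..<int n}. int c dvd x} \<subseteq> carrier (integer_mod_group n)"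
      using assms by (auto simp: carrier_integer_mod_group)
    show "{x \<in> {0..<int n}. int c dvd x} \<noteq> {}" using assms by force
  \<comment> \<open>Since \<open>c\<close> divides \<open>n\<close>, reduction mod \<open>n\<close>
    preserves divisibility by \<open>c\<close>, which gives closure.\<close>
  qed (use assms in \<open>auto simp: carrier_integer_mod_group dvd_mod_iff\<close>)
qed

text \<open>Lagrange gives the divisibility. Every element of \<open>K\<close> is annihilated by
  \<open>card K\<close>, hence is a multiple of \<open>n div card K\<close>; there are only
  \<open>card K\<close> such multiples, so the inclusion is an equality.\<close>

lemma subgroup_integer_mod_group_eq_multiples:
  assumes "n > 0" "subgroup K (integer_mod_group n)"
  shows "card K dvd n" "K = {x \<in> {0..<int n}. int (n div card K) dvd x}"
proof -
  interpret group "integer_mod_group n" by simp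
  have carr: "carrier (integer_mod_group n) = {0..<int n}"
    using assms by (simp add: carrier_integer_mod_group)
  have sub: "K \<subseteq> {0..<int n}" using assms subgroup.subset carr by metis
  show dvd: "card K dvd n"
    using lagrange[OF assms(2)] by (metis card_atLeastLessThan_int carr diff_zero dvd_triv_right nat_int order_def)
  then obtain c where n: "n = card K * c" by blast
  with assms have pos: "card K > 0" "c > 0" by auto
  \<comment> \<open>Viewing \<open>K\<close> as a group of its own yields the exponent
    \<open>card K\<close> instead of \<open>n\<close>.\<close>
  interpret K: group "integer_mod_group n\<lparr>carrier := K\<rparr>"
    using assms(2) by (rule subgroup_imp_group)
  have "int (n div card K) dvd x" if "x \<in> K" for x
  proof -
    have "x [^]\<^bsub>integer_mod_group n\<lparr>carrier := K\<rparr>\<^esub> card K = 0"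
      using K.pow_order_eq_1[of x] that by (simp add: order_def)
    then have "int n dvd int (card K) * x"
      by (simp flip: nat_pow_consistent) (simp add: dvd_eq_mod_eq_0)
    then have "int (card K) * int c dvd int (card K) * x"
      using n by (metis of_nat_mult)
    then have "int c dvd x" using pos by simp
    moreover have "n div card K = c" using n pos by (metis nonzero_mult_div_cancel_left less_numeral_extra(3))
    ultimately show ?thesis by simp
  qed
  with sub have "K \<subseteq> {x \<in> {0..<int n}. int (n div card K) dvd x}" by auto
  then show "K = {x \<in> {0..<int n}. int (n div card K) dvd x}"
    using card_multiples_below[OF assms(1) dvd] 
    by (intro card_subset_eq finite_subset[OF Collect_restrict]) simp_all
qed

text \<open>A subgroup is recovered from its order as a set of multiples, and the multiples of
  \<open>n div d\<close> realise each divisor \<open>d\<close>.\<close>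

lemma bij_betw_card_subgroups_integer_mod_group:
  assumes "n > 0"
  shows "bij_betw card {K. subgroup K (integer_mod_group n)} {d. d dvd n}"
proof (rule bij_betwI')
  fix K L assume "K \<in> {K. subgroup K (integer_mod_group n)}" "L \<in> {K. subgroup K (integer_mod_group n)}"
  then show "card K = card L \<longleftrightarrow> K = L"
    using subgroup_integer_mod_group_eq_multiples[OF assms] by (metis mem_Collect_eq)
next
  fix d assume "d \<in> {d. d dvd n}"
  then show "\<exists>K\<in>{K. subgroup K (integer_mod_group n)}. d = card K"
    using assms card_multiples_below[of n d] subgroup_multiples_integer_mod_group[of n "n div d"]
    by (metis div_dvd_iff_mult dvd_triv_left mem_Collect_eq dvd_div_mult_self dvd_0_left_iff less_numeral_extra(3))
qed (use subgroup_integer_mod_group_eq_multiples[OF assms] in auto)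

text \<open>The added 1 accounts for the trivial subgroup, which matches the divisor 1 of
  \<open>m\<close> but is not a vertex.\<close>

lemma out_degree_coprime_graph_integer_mod_group:
  assumes "proper_subgroup H (integer_mod_group n)"
    and "n = card H * m" "coprime (card H) m" "n > 0"
  shows "out_degree (coprime_graph (integer_mod_group n)) H + 1 = card {d. d dvd m}"
proof -
  let ?G = "integer_mod_group n"
  let ?S = "{K. subgroup K ?G \<and> card K dvd m}"
  interpret group ?G by simp
  have H: "subgroup H ?G" "H \<noteq> {0}" using assms(1) by (auto simp: proper_subgroup_def)
  have triv: "subgroup {0} ?G" using triv_subgroup by simp
  have inj: "inj_on card {K. subgroup K ?G}"
    using bij_betw_card_subgroups_integer_mod_group[OF \<open>n > 0\<close>] by (simp add: bij_betw_def)
  have "card H \<noteq> 1"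
    using inj_onD[OF inj, of H "{0}"] H triv by auto
  have carr: "card (carrier ?G) = n" using \<open>n > 0\<close> by (simp add: carrier_integer_mod_group)
  have coprime_iff: "coprime (card H) (card K) \<longleftrightarrow> card K dvd m" if "subgroup K ?G" for K
  proof
    assume "coprime (card H) (card K)"
    moreover have "card K dvd card H * m"
      using subgroup_integer_mod_group_eq_multiples(1)[OF \<open>n > 0\<close> that] assms(2) by simp
    ultimately show "card K dvd m"
      by (simp add: coprime_dvd_mult_right_iff coprime_commute)
  next
    assume "card K dvd m"
    then show "coprime (card H) (card K)" using assms(3) by (rule coprime_divisors[OF dvd_refl])
  qed
  have "{K. proper_subgroup K ?G \<and> K \<noteq> H \<and> coprime (card H) (card K)} = ?S - {{0}}"
  proof -
    \<comment> \<open>As \<open>card H\<close> is not 1 and divides \<open>n\<close>, neither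
      \<open>H\<close> nor the whole group lies in \<open>?S\<close>, so only \<open>{0}\<close> has
      to be removed.\<close>
    have "\<not> coprime (card H) (card H)" "\<not> coprime (card H) (card (carrier ?G))"
      using \<open>card H \<noteq> 1\<close> assms(2) carr by auto
    then have "\<not> card H dvd m" "\<not> card (carrier ?G) dvd m"
      using coprime_iff H(1) subgroup_self by blast+
    then show ?thesis using coprime_iff by (auto simp: proper_subgroup_def)
  qed
  then have "out_degree (coprime_graph ?G) H = card (?S - {{0}})"
    by (simp add: out_degree_coprime_graph[OF assms(1)])
  moreover have "finite ?S"
    by (rule finite_subset[of _ "Pow (carrier ?G)"])
       (use \<open>n > 0\<close> subgroup.subset[of _ ?G] in \<open>force simp: carrier_integer_mod_group\<close>)+
  moreover have "{0} \<in> ?S" using triv by simp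
  ultimately have "out_degree (coprime_graph ?G) H + 1 = card ?S"
    by (metis Suc_eq_plus1 card.remove)
  also have "card ?S = card (card ` ?S)"
    using inj by (intro card_image[symmetric]) (auto elim: inj_on_subset)
  also have "card ` ?S = {d. d dvd m}"
  proof -
    have "card ` {K. subgroup K ?G} = {d. d dvd n}"
      using bij_betw_card_subgroups_integer_mod_group[OF \<open>n > 0\<close>] by (simp add: bij_betw_def)
    \<comment> \<open>All divisors of \<open>n\<close> occur as orders, and those of
      \<open>m\<close> are among them because \<open>m\<close> divides \<open>n\<close>.\<close>
    moreover have "card ` ?S = card ` {K. subgroup K ?G} \<inter> {d. d dvd m}" by auto
    ultimately show ?thesis using assms(2) by auto
  qed
  finally show ?thesis .
qed

theorem theorem2p7:
  fixes n k r :: nat and p \<alpha> i :: "nat \<Rightarrow> nat" and H :: "int set"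
  assumes "\<And>j. j \<in> {1..k} \<Longrightarrow> prime (p j)"
    and "inj_on p {1..k}"
    and "\<And>j. j \<in> {1..k} \<Longrightarrow> \<alpha> j \<ge> 1"
    and "n = (\<Prod>j\<in>{1..k}. p j ^ \<alpha> j)"
    and "n > 1" and "\<not> prime n"
    and "proper_subgroup H (integer_mod_group n)"
    and "i ` {1..r} \<subseteq> {1..k}" and "inj_on i {1..r}"
    and "card H = (\<Prod>s\<in>{1..r}. p (i s) ^ \<alpha> (i s))"
  shows "int (out_degree (coprime_graph (integer_mod_group n)) H) =
           (\<Prod>j\<in>{1..k} - i ` {1..r}. int (\<alpha> j) + 1) - 1"
proof -
  define I where "I = i ` {1..r}"
  define m where "m = (\<Prod>j\<in>{1..k} - I. p j ^ \<alpha> j)"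
  have I: "I \<subseteq> {1..k}" using assms(8) by (simp add: I_def)
  \<comment> \<open>Injectivity of \<open>i\<close> turns the product over positions into one over
    the index set \<open>I\<close>.\<close>
  have card_H: "card H = (\<Prod>j\<in>I. p j ^ \<alpha> j)"
    using assms(9,10) by (simp add: I_def prod.reindex)
  have n: "n = card H * m"
    using prod.subset_diff[OF I, of "\<lambda>j. p j ^ \<alpha> j"] assms(4) by (simp add: card_H m_def mult.commute)
  \<comment> \<open>Full prime powers in \<open>card H\<close> leave only other primes for
    \<open>m\<close>, so \<open>card H\<close> and \<open>m\<close> are coprime.\<close>
  have "coprime (p j ^ \<alpha> j) (p l ^ \<alpha> l)" if "j \<in> I" "l \<in> {1..k} - I" for j l
  proof -
    have "p j \<noteq> p l" using that I inj_onD[OF assms(2), of j l] by blast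
    then show ?thesis using that I assms(1) by (auto intro!: primes_coprime)
  qed
  then have "coprime (card H) m"
    unfolding card_H m_def by (intro prod_coprime_left prod_coprime_right)
  then have "out_degree (coprime_graph (integer_mod_group n)) H + 1 = card {d. d dvd m}"
    using assms(5,7) n by (intro out_degree_coprime_graph_integer_mod_group) linarith+
  also have "\<dots> = (\<Prod>j\<in>{1..k} - I. \<alpha> j + 1)"
    unfolding m_def using assms(1,2)
    by (intro card_divisors_prod_prime_powers) (auto elim: inj_on_subset)
  finally have "int (out_degree (coprime_graph (integer_mod_group n)) H) + 1 =
      (\<Prod>j\<in>{1..k} - I. int (\<alpha> j) + 1)"
    by (simp flip: of_nat_Suc add: of_nat_prod algebra_simps)
  then show ?thesis by (simp add: I_def)
qed

end
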